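(* Let $n\ge 2$ be an integer, let $J$ and $J'$ be Jordan rings with $J$ $2$-torsion free, and let $e$ be a nontrivial idempotent in $J$. Let $J=J_1\oplus J_{\frac12}\oplus J_0$ be the Peirce decomposition of $J$ with respect to $e$. Suppose that $J$ satisfies the following conditions: (i) for $i\in\{1,0\}$ and $a_i\in J_i$: if $t_{\frac12}a_i=0$ for all $t_{\frac12}\in J_{\frac12}$, then $a_i=0$; (ii) for $a_0\in J_0$: if $t_0a_0=0$ for all $t_0\in J_0$, then $a_0=0$; (iii) for $a_{\frac12}\in J_{\frac12}$: if $t_0a_{\frac12}=0$ for all $t_0\in J_0$, then $a_{\frac12}=0$. Then every $n$-multiplicative isomorphism $\varphi$ from $J$ onto $J'$ is additive, i.e. $\varphi(a+b)=\varphi(a)+\varphi(b)$ for all $a,b\in J$.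
   Context: Rings are not necessarily associative and not necessarily unital (an abelian group with a biadditive product). A ring $J$ is Jordan if $xy=yx$ and $(x^2y)x=x^2(yx)$ for all $x,y\in J$. For a positive integer $k$, $J$ is $k$-torsion free if $kx=0$ implies $x=0$ for $x\in J$. A nontrivial idempotent is a nonzero $e\in J$ with $e^2=e$ that is not the multiplicative identity of $J$. The Peirce decomposition of $J$ with respect to $e$ is $J=J_1\oplus J_{\frac12}\oplus J_0$ with $J_i=\{x\in J: ex=ix\}$, $i=0,\frac12,1$ (for $i=\frac12$ the condition means $2(ex)=x$). A nonassociative monomial of degree $1$ is a single variable; a nonassociative monomial of degree $n>1$ is an expression $(u)(v)$ with $u$ a nonassociative monomial of some degree $i$ and $v$ one of degree $n-i$ ($1\le i\le n-1$). For a monomial $m=m(x_1,\dots,x_n)$ of degree $n$, $m(y_1,\dots,y_n)$ denotes the value obtained by substituting $y_1,\dots,y_n$. An $n$-multiplicative isomorphism of $J$ onto $J'$ (also called an $n$-multiplicative map) is a bijective map $\varphi:J\to J'$, not assumed additive, such that $\varphi(m(x_1,\dots,x_n))=m(\varphi(x_1),\dots,\varphi(x_n))$ for all nonassociative monomials $m$ of degree $n$ and all $x_1,\dots,x_n\in J$. *)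

theory Defs
  imports Main
begin

class nonassoc_ring = ab_group_add + times +
  assumes mult_add_distrib_left: "x * (y + z) = x * y + x * z"
    and mult_add_distrib_right: "(x + y) * z = x * z + y * z"

class jordan_ring = nonassoc_ring +
  assumes jordan_commute: "x * y = y * x"
    and jordan_identity: "((x * x) * y) * x = (x * x) * (y * x)"

text \<open>The ambient group carries no scalar action of the naturals, so the multiple of
  an element by \<open>k\<close> is the sum of \<open>k\<close> copies of it.\<close>

definition torsion_free :: "nat \<Rightarrow> 'a::ab_group_add itself \<Rightarrow> bool"
  where "torsion_free k _ \<longleftrightarrow> (\<forall>x::'a. (\<Sum>i<k. x) = 0 \<longrightarrow> x = 0)"

definition nontrivial_idempotent :: "'a::nonassoc_ring \<Rightarrow> bool"
  where "nontrivial_idempotent e \<longleftrightarrow>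
    e \<noteq> 0 \<and> e * e = e \<and> \<not> (\<forall>x. e * x = x \<and> x * e = x)"

definition peirce_one :: "'a::nonassoc_ring \<Rightarrow> 'a set"
  where "peirce_one e = {x. e * x = x}"

definition peirce_half :: "'a::nonassoc_ring \<Rightarrow> 'a set"
  where "peirce_half e = {x. e * x + e * x = x}"

definition peirce_zero :: "'a::nonassoc_ring \<Rightarrow> 'a set"
  where "peirce_zero e = {x. e * x = 0}"

datatype monomial = Var nat | Prod monomial monomial

primrec degree :: "monomial \<Rightarrow> nat"
  where
    "degree (Var i) = 1"
  | "degree (Prod u v) = degree u + degree v"

primrec vars :: "monomial \<Rightarrow> nat set"
  where
    "vars (Var i) = {i}"
  | "vars (Prod u v) = vars u \<union> vars v"

primrec subst_value :: "(nat \<Rightarrow> 'a::nonassoc_ring) \<Rightarrow> monomial \<Rightarrow> 'a"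
  where
    "subst_value y (Var i) = y i"
  | "subst_value y (Prod u v) = subst_value y u * subst_value y v"

text \<open>A monomial of degree \<open>n\<close> is written in variables with indices \<open>1, \<dots>, n\<close>, in any order
  and possibly with repetitions. Requiring each index to occur exactly once, in increasing
  order, gives the same maps: the elements substituted are arbitrary, so they may be
  permuted and identified at will.\<close>

definition n_multiplicative_iso ::
    "nat \<Rightarrow> ('a::nonassoc_ring \<Rightarrow> 'b::nonassoc_ring) \<Rightarrow> bool"
  where "n_multiplicative_iso n \<phi> \<longleftrightarrow>
    bij \<phi> \<and>
    (\<forall>m. degree m = n \<and> vars m \<subseteq> {1..n} \<longrightarrow>
      (\<forall>x. \<phi> (subst_value x m) = subst_value (\<lambda>i. \<phi> (x i)) m))"

text \<open>The Peirce spaces of an idempotent decompose a \<open>2\<close>-torsion free Jordan ring, so the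
  decomposition need not be assumed.\<close>

lemma nonassoc_mult_zero_right: "x * 0 = (0::'a::nonassoc_ring)"
  using mult_add_distrib_left[of x 0 0] by simp

lemma nonassoc_mult_minus_right: "x * (- y) = - (x * (y::'a::nonassoc_ring))"
  using mult_add_distrib_left[of x y "- y"]
  by (simp add: nonassoc_mult_zero_right eq_neg_iff_add_eq_0 add.commute)

lemma nonassoc_mult_zero_left: "0 * x = (0::'a::nonassoc_ring)"
  using mult_add_distrib_right[of 0 0 x] by simp

lemma nonassoc_mult_minus_left: "(- x) * y = - (x * (y::'a::nonassoc_ring))"
  using mult_add_distrib_right[of x "- x" y]
  by (simp add: nonassoc_mult_zero_left eq_neg_iff_add_eq_0 add.commute)

lemma nonassoc_mult_diff_right: "x * (y - z) = x * y - x * (z::'a::nonassoc_ring)"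
  using mult_add_distrib_left[of x y "- z"] by (simp add: nonassoc_mult_minus_right)

lemma nonassoc_mult_diff_left: "(x - y) * z = x * z - y * (z::'a::nonassoc_ring)"
  using mult_add_distrib_right[of x "- y" z] by (simp add: nonassoc_mult_minus_left)

lemma jordan_linearized:
  fixes x y z :: "'a::jordan_ring"
  assumes "torsion_free 2 TYPE('a)"
  shows "((x * z) * y) * x + ((x * z) * y) * x + ((x * x) * y) * z
    = (x * z) * (y * x) + (x * z) * (y * x) + (x * x) * (y * z)"
proof -
  define d where "d = ((x * z) * y) * x + ((x * z) * y) * x + ((x * x) * y) * z
    - ((x * z) * (y * x) + (x * z) * (y * x) + (x * x) * (y * z))"
  define q where "q = ((x * z) * y) * z + ((x * z) * y) * z + ((z * z) * y) * x
    - ((x * z) * (y * z) + (x * z) * (y * z) + (z * z) * (y * x))"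
  have zx: "z * x = x * z" by (rule jordan_commute)
  note distribs = mult_add_distrib_left mult_add_distrib_right
  have a: "d + q = 0"
    using jordan_identity[of "x + z" y] jordan_identity[of x y] jordan_identity[of z y]
    unfolding d_def q_def by (simp add: distribs zx algebra_simps)
  have b: "q - d = 0"
    using jordan_identity[of "x - z" y] jordan_identity[of x y] jordan_identity[of z y]
    unfolding d_def q_def
    by (simp add: distribs nonassoc_mult_diff_left nonassoc_mult_diff_right zx algebra_simps)
  from a b have "q = d" and "q = - d" by (simp_all add: eq_neg_iff_add_eq_0 add.commute)
  then have "d + d = 0" by (metis add.right_inverse)
  then have "(\<Sum>i<(2::nat). d) = 0" by (simp add: numeral_2_eq_2)
  with assms have "d = 0" unfolding torsion_free_def by blast
  then show ?thesis by (simp add: d_def)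
qed

theorem peirce_decomposition:
  fixes e x :: "'a::jordan_ring"
  assumes "torsion_free 2 TYPE('a)" and "e * e = e"
  shows "\<exists>!(a, b, c). a \<in> peirce_one e \<and> b \<in> peirce_half e \<and> c \<in> peirce_zero e
    \<and> x = a + b + c"
proof -
  define L where "L = (\<lambda>z. e * z)"
  have L_add: "L (u + v) = L u + L v" for u v
    by (simp add: L_def mult_add_distrib_left)
  have L_diff: "L (u - v) = L u - L v" for u v
    by (simp add: L_def nonassoc_mult_diff_right)
  have cubic: "L (L (L z)) + L (L (L z)) = L (L z) + L (L z) + L (L z) - L z" for z
  proof -
    have right: "z * e = L z" "(L z) * e = L (L z)" "(L (L z)) * e = L (L (L z))"
      by (simp_all add: L_def jordan_commute[of z e] jordan_commute[of "e * z" e]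
          jordan_commute[of "e * (e * z)" e])
    have "L (L (L z)) + L (L (L z)) + L z = L (L z) + L (L z) + L (L z)"
      using jordan_linearized[OF assms(1), of e z e] right
      unfolding assms(2) by (simp add: L_def)
    then show ?thesis by (simp add: eq_diff_eq)
  qed
  define a where "a = L (L x) + L (L x) - L x"
  define c where "c = x - (L x + L x + L x) + (L (L x) + L (L x))"
  define b where "b = x - a - c"
  have La: "L a = a" unfolding a_def L_add L_diff cubic by simp
  have Lc: "L c = 0" unfolding c_def L_add L_diff cubic by simp
  have Lb: "L b + L b = b"
  proof -
    have "L b = L x - a" unfolding b_def L_diff La Lc by simp
    then have "L b + L b = (L x - a) + (L x - a)" by simp
    also have "\<dots> = b" unfolding b_def c_def a_def by (simp add: algebra_simps)
    finally show ?thesis .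
  qed
  show ?thesis
  proof (rule ex1I[of _ "(a, b, c)"])
    show "case (a, b, c) of (a, b, c) \<Rightarrow>
      a \<in> peirce_one e \<and> b \<in> peirce_half e \<and> c \<in> peirce_zero e \<and> x = a + b + c"
      using La Lb Lc
      by (simp add: L_def peirce_one_def peirce_half_def peirce_zero_def b_def)
  next
    fix p
    assume p: "case p of (a, b, c) \<Rightarrow>
      a \<in> peirce_one e \<and> b \<in> peirce_half e \<and> c \<in> peirce_zero e \<and> x = a + b + c"
    obtain a' b' c' where eq: "p = (a', b', c')" by (cases p)
    with p have La': "L a' = a'" and Lb': "L b' + L b' = b'" and Lc': "L c' = 0"
      and x: "x = a' + b' + c'"
      by (auto simp: L_def peirce_one_def peirce_half_def peirce_zero_def)
    have Lx: "L x = a' + L b'" by (simp add: x L_add La' Lc')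
    have LLb: "L (L b') + L (L b') = L b'" using Lb' by (metis L_add)
    have LLx: "L (L x) + L (L x) = a' + a' + L b'"
    proof -
      have "L (L x) + L (L x) = a' + a' + (L (L b') + L (L b'))"
        by (simp add: Lx L_add La' ac_simps)
      then show ?thesis by (simp only: LLb)
    qed
    have "a = a'" unfolding a_def LLx unfolding Lx by simp
    moreover have "c = c'"
    proof -
      have "c = (a' + b' + c') - (a' + (L b' + L b'))"
        unfolding c_def LLx unfolding Lx by (simp add: x algebra_simps)
      then show ?thesis unfolding Lb' by simp
    qed
    ultimately show "p = (a, b, c)" by (simp add: eq b_def x algebra_simps)
  qed
qed

end

theory Submission
  imports Defs
begin

text \<open>Pulling the addition of the target back along \<open>\<phi>\<close> gives a second commutative group law \<open>\<oplus>\<close>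
  on the source, over which every product of \<open>n\<close> factors distributes; the claim is that \<open>\<oplus>\<close> is
  \<open>+\<close>. Products of the form \<open>t\<^sub>1 (t\<^sub>2 (\<dots> (t\<^sub>k x)))\<close> with \<open>k = n - 1\<close> suffice. Taking all \<open>t\<^sub>i\<close> in \<open>J\<^sub>0\<close>
  detects the components in \<open>J\<^sub>1\<^sub>/\<^sub>2\<close> and \<open>J\<^sub>0\<close> and kills \<open>J\<^sub>1\<close>; taking all \<open>t\<^sub>i\<close> equal to \<open>e\<close> detects the
  components in \<open>J\<^sub>1\<close> and \<open>J\<^sub>1\<^sub>/\<^sub>2\<close> and kills \<open>J\<^sub>0\<close>; a single factor from \<open>J\<^sub>1\<^sub>/\<^sub>2\<close> recovers the remaining
  component. This settles \<open>a \<oplus> b\<close> for \<open>a\<close> and \<open>b\<close> in different Peirce spaces. Inside \<open>J\<^sub>1\<^sub>/\<^sub>2\<close> one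
  compares the two expansions of \<open>(e + a)(e + b) = (e \<oplus> a)(e \<oplus> b)\<close>, and \<open>J\<^sub>1\<close>, \<open>J\<^sub>0\<close> follow by
  multiplying into \<open>J\<^sub>1\<^sub>/\<^sub>2\<close>.\<close>

section \<open>Distributivity, cancellation of 2, iterated left multiplication\<close>

lemmas nonassoc_distribs =
  mult_add_distrib_left mult_add_distrib_right
  nonassoc_mult_diff_left nonassoc_mult_diff_right
  nonassoc_mult_zero_left nonassoc_mult_zero_right

lemma torsion_free_2D:
  fixes x :: "'a::ab_group_add"
  assumes "torsion_free 2 TYPE('a)" and "x + x = 0"
  shows "x = 0"
proof -
  have "(\<Sum>i<(2::nat). x) = 0"
    using assms(2) by (simp add: numeral_2_eq_2)
  then show ?thesis
    using assms(1) unfolding torsion_free_def by blast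
qed

definition mults :: "'a::nonassoc_ring list \<Rightarrow> 'a \<Rightarrow> 'a"
  where "mults ts = foldr (*) ts"

lemma mults_simps [simp]:
  "mults [] x = x"
  "mults (t # ts) x = t * mults ts x"
  by (simp_all add: mults_def)

lemma mults_append [simp]: "mults (ss @ ts) x = mults ss (mults ts x)"
  by (simp add: mults_def)

lemma mults_0 [simp]: "mults ts 0 = 0"
  by (induction ts) (simp_all add: nonassoc_mult_zero_right)

lemma mults_add: "mults ts (x + y) = mults ts x + mults ts y"
  by (induction ts) (simp_all add: mult_add_distrib_left)

lemma mults_diff: "mults ts (x - y) = mults ts x - mults ts y"
  by (induction ts) (simp_all add: nonassoc_mult_diff_right)

subsection \<open>Peirce calculus\<close>

locale peirce =
  fixes e :: "'a::jordan_ring"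
  assumes torsion_free_2: "torsion_free 2 TYPE('a)"
    and idem: "e * e = e"
begin

abbreviation "J1 \<equiv> peirce_one e"
abbreviation "Jh \<equiv> peirce_half e"
abbreviation "J0 \<equiv> peirce_zero e"

lemmas peirce_defs = peirce_one_def peirce_half_def peirce_zero_def

lemma e_in_J1: "e \<in> J1"
  by (simp add: peirce_one_def idem)

lemma zero_in [simp]: "0 \<in> J1" "0 \<in> Jh" "0 \<in> J0"
  by (simp_all add: peirce_defs nonassoc_mult_zero_right)

lemma add_in:
  "x \<in> J1 \<Longrightarrow> y \<in> J1 \<Longrightarrow> x + y \<in> J1"
  "x \<in> Jh \<Longrightarrow> y \<in> Jh \<Longrightarrow> x + y \<in> Jh"
  "x \<in> J0 \<Longrightarrow> y \<in> J0 \<Longrightarrow> x + y \<in> J0"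
  by (auto simp: peirce_defs nonassoc_distribs) (metis add.assoc add.commute)

lemma diff_in:
  "x \<in> J1 \<Longrightarrow> y \<in> J1 \<Longrightarrow> x - y \<in> J1"
  "x \<in> J0 \<Longrightarrow> y \<in> J0 \<Longrightarrow> x - y \<in> J0"
  by (auto simp: peirce_defs nonassoc_distribs)

lemma decompose:
  obtains p q r where "p \<in> J1" "q \<in> Jh" "r \<in> J0" "x = p + q + r"
  using ex1_implies_ex[OF peirce_decomposition[OF torsion_free_2 idem, of x]] that
  by (auto split: prod.splits)

lemma components_eq:
  assumes "p + q + r = p' + q' + r'"
    and "p \<in> J1" "q \<in> Jh" "r \<in> J0" "p' \<in> J1" "q' \<in> Jh" "r' \<in> J0"
  shows "p = p' \<and> q = q' \<and> r = r'"
proof -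
  have "(p, q, r) = (p', q', r')"
    using peirce_decomposition[OF torsion_free_2 idem, of "p + q + r"] assms
    by (elim ex1E) (metis (mono_tags, lifting) case_prodI)
  then show ?thesis by simp
qed

section \<open>Intersections and products of Peirce spaces\<close>

lemma half_zero_inter: "x \<in> Jh \<Longrightarrow> x \<in> J0 \<Longrightarrow> x = 0"
  by (simp add: peirce_defs)

lemma one_zero_inter: "x \<in> J1 \<Longrightarrow> x \<in> J0 \<Longrightarrow> x = 0"
  by (simp add: peirce_defs)

text \<open>The linearized Jordan identity at \<open>e\<close> contains both sides, \<open>A\<close>
  and \<open>B\<close>, and otherwise only terms with a factor \<open>e * z\<close>. These vanish
  for \<open>z\<close> in \<open>J0\<close>; for \<open>z\<close> in \<open>J1\<close> they are
  copies of the two sides, and the identity reads \<open>2A + B = 2B + A\<close>.\<close>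

lemma e_mult_assoc:
  assumes "z \<in> J1 \<or> z \<in> J0"
  shows "e * (y * z) = (e * y) * z"
proof -
  have *: "((e * z) * y) * e + ((e * z) * y) * e + (e * y) * z
    = (e * z) * (y * e) + (e * z) * (y * e) + e * (y * z)"
    using jordan_linearized[OF torsion_free_2, of e z y] unfolding idem .
  from assms show ?thesis
  proof
    assume "z \<in> J0"
    then show ?thesis
      using * by (simp add: peirce_zero_def nonassoc_mult_zero_left)
  next
    assume "z \<in> J1"
    then have "(z * y) * e + (z * y) * e + (e * y) * z
        = z * (y * e) + z * (y * e) + e * (y * z)"
      using * by (simp add: peirce_one_def)
    moreover have "(z * y) * e = e * (y * z)" "z * (y * e) = (e * y) * z"
      by (metis jordan_commute)+
    ultimately have "e * (y * z) + e * (y * z) + (e * y) * z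
        = (e * y) * z + (e * y) * z + e * (y * z)"
      by simp
    then show ?thesis
      by (simp add: algebra_simps)
  qed
qed

lemma mult_J0_J0: "x \<in> J0 \<Longrightarrow> y \<in> J0 \<Longrightarrow> x * y \<in> J0"
  using e_mult_assoc[of y x] by (simp add: peirce_zero_def nonassoc_mult_zero_left)

lemma mult_J0_J1:
  assumes "x \<in> J0" "y \<in> J1"
  shows "x * y = 0"
proof -
  have "x * y \<in> J0"
    using e_mult_assoc[of y x] assms by (simp add: peirce_zero_def nonassoc_mult_zero_left)
  moreover have "y * x \<in> J1"
    using e_mult_assoc[of x y] assms by (simp add: peirce_one_def)
  ultimately show ?thesis
    using one_zero_inter jordan_commute[of x y] by simp
qed

lemma mult_Jh:
  assumes "x \<in> Jh" "y \<in> J1 \<or> y \<in> J0"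
  shows "x * y \<in> Jh"
proof -
  have "e * (x * y) + e * (x * y) = (e * x + e * x) * y"
    using e_mult_assoc[OF assms(2), of x] by (simp add: mult_add_distrib_right)
  with assms(1) show ?thesis by (simp add: peirce_half_def)
qed

lemma mult_J0_Jh: "x \<in> J0 \<Longrightarrow> y \<in> Jh \<Longrightarrow> x * y \<in> Jh"
  using mult_Jh[of y x] jordan_commute[of x y] by simp

lemma mult_e_Jh: "x \<in> Jh \<Longrightarrow> e * x \<in> Jh"
  using mult_Jh[of x e] e_in_J1 jordan_commute[of x e] by simp

text \<open>A further polarization of \<open>jordan_linearized\<close>: the mixed part of its value
  at \<open>x + w\<close> is twice the claim.\<close>

lemma jordan_full_linearized:
  fixes w x y z :: 'a
  shows "((x * z) * y) * w + ((w * z) * y) * x + ((x * w) * y) * z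
    = (x * z) * (y * w) + (w * z) * (y * x) + (x * w) * (y * z)"
proof -
  define d where "d = ((x * z) * y) * w + ((w * z) * y) * x + ((x * w) * y) * z
    - ((x * z) * (y * w) + (w * z) * (y * x) + (x * w) * (y * z))"
  define F where "F u = ((u * z) * y) * u + ((u * z) * y) * u + ((u * u) * y) * z
    - ((u * z) * (y * u) + (u * z) * (y * u) + (u * u) * (y * z))" for u
  have "F u = 0" for u
    using jordan_linearized[OF torsion_free_2, of u z y] by (simp add: F_def)
  moreover have "F (x + w) - F x - F w = d + d"
    unfolding d_def F_def by (simp add: nonassoc_distribs jordan_commute[of w x] algebra_simps)
  ultimately have "d + d = 0"
    by simp
  then have "d = 0"
    by (rule torsion_free_2D[OF torsion_free_2])
  then show ?thesis
    by (simp add: d_def)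
qed

text \<open>The fully polarized identity with \<open>e\<close> in two places gives
  \<open>e * (e * (x * y)) = e * (x * y)\<close>, which splits \<open>x * y\<close> into
  \<open>e * (x * y)\<close> in \<open>J1\<close> and a rest in \<open>J0\<close>.\<close>

lemma mult_Jh_Jh:
  assumes "x \<in> Jh" "y \<in> Jh"
  obtains p r where "p \<in> J1" "r \<in> J0" "x * y = p + r"
proof -
  \<comment> \<open>These are the halves of \<open>x\<close> and \<open>y\<close>, obtained without
    dividing by 2.\<close>
  define a b where "a = e * x" and "b = e * y"
  have x: "x = a + a" and y: "y = b + b"
    using assms by (simp_all add: a_def b_def peirce_half_def)
  have a: "e * a + e * a = a" and b: "e * b + e * b = b"
    using assms by (simp_all add: a_def b_def peirce_half_def mult_add_distrib_left[symmetric])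
  have "(a * e) * y = a * b"
  proof -
    have "(a * e) * y = (e * a + e * a) * b"
      by (simp add: y nonassoc_distribs jordan_commute[of a e])
    then show ?thesis by (simp only: a)
  qed
  moreover have "(b * e) * x = a * b"
  proof -
    have "(b * e) * x = (e * b + e * b) * a"
      by (simp add: x nonassoc_distribs jordan_commute[of b e])
    then show ?thesis by (simp only: b jordan_commute[of b a])
  qed
  moreover have "(a * e) * y + ((y * x) * e) * e + (b * e) * x = a * b + (y * x) * e + b * a"
    using jordan_full_linearized[of e x e y] by (simp add: idem a_def b_def)
  ultimately have "e * (e * (x * y)) = e * (x * y)"
    by (simp add: jordan_commute[of b a] jordan_commute[of y x] jordan_commute[of _ e])
  then have "e * (x * y) \<in> J1" "x * y - e * (x * y) \<in> J0"
    by (simp_all add: peirce_defs nonassoc_distribs)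
  with that[of "e * (x * y)" "x * y - e * (x * y)"] show thesis by simp
qed

section \<open>Iterated products with elements of \<open>J0\<close> and with
  \<open>e\<close>\<close>

lemma mults_J0_simps:
  assumes "set ts \<subseteq> J0"
  shows mults_J0_in_Jh: "x \<in> Jh \<Longrightarrow> mults ts x \<in> Jh"
    and mults_J0_in_J0: "x \<in> J0 \<Longrightarrow> mults ts x \<in> J0"
    and mults_J0_J1: "x \<in> J1 \<Longrightarrow> ts \<noteq> [] \<Longrightarrow> mults ts x = 0"
  using assms
proof (induction ts)
  case (Cons t ts)
  {
    case 1
    then show ?case using Cons.IH by (simp add: mult_J0_Jh)
  next
    case 2
    then show ?case using Cons.IH by (simp add: mult_J0_J0)
  next
    case 3
    then show ?case using Cons.IH
      by (cases ts) (simp_all add: mult_J0_J1 nonassoc_mult_zero_right)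
  }
qed simp_all

abbreviation E :: "nat \<Rightarrow> 'a \<Rightarrow> 'a"
  where "E k \<equiv> mults (replicate k e)"

lemma E_J1: "x \<in> J1 \<Longrightarrow> E k x = x"
  by (induction k) (simp_all add: peirce_one_def)

lemma E_J0: "x \<in> J0 \<Longrightarrow> k > 0 \<Longrightarrow> E k x = 0"
proof (induction k)
  case (Suc k)
  then show ?case
    by (cases k) (simp_all add: peirce_zero_def nonassoc_mult_zero_right)
qed simp

lemma E_in_J0: "x \<in> J0 \<Longrightarrow> E k x \<in> J0"
  by (cases "k = 0") (simp_all add: E_J0)

lemma E_Jh: "x \<in> Jh \<Longrightarrow> E k x \<in> Jh"
  by (induction k) (simp_all add: mult_e_Jh)

lemma E_eq_0: "x \<in> Jh \<Longrightarrow> E k x = 0 \<Longrightarrow> x = 0"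
proof (induction k)
  case (Suc k)
  have "E k x = e * E k x + e * E k x"
    using E_Jh[OF Suc.prems(1), of k] by (simp add: peirce_half_def)
  with Suc show ?case by simp
qed simp

text \<open>Doubling inverts each factor \<open>e\<close>, as \<open>e * (x + x) = x\<close> on
  \<open>Jh\<close>.\<close>

lemma E_Jh_surj: "x \<in> Jh \<Longrightarrow> \<exists>y\<in>Jh. E k y = x"
proof (induction k arbitrary: x)
  case (Suc k)
  then obtain y where "y \<in> Jh" "E k y = x + x"
    using add_in(2)[of x x] by blast
  with Suc.prems show ?case
    by (intro bexI[of _ y]) (simp_all add: mult_add_distrib_left peirce_half_def)
qed simp

text \<open>For \<open>k > 0\<close> the map \<open>E k\<close> is the identity on
  \<open>J1\<close>, injective on \<open>Jh\<close> and zero on \<open>J0\<close>, so its kernel is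
  \<open>J0\<close>.\<close>

lemma E_cong_imp:
  assumes "E k x = E k y" "k > 0"
  shows "x - y \<in> J0"
proof -
  obtain p q r where d: "p \<in> J1" "q \<in> Jh" "r \<in> J0" "x - y = p + q + r"
    by (rule decompose)
  have "p + E k q + 0 = E k (p + q + r)"
    using assms(2) d(1,3) by (simp add: mults_add E_J1 E_J0)
  also have "\<dots> = 0 + 0 + 0"
    using assms(1) by (simp add: mults_diff flip: d(4))
  finally have "p = 0" "E k q = 0"
    using components_eq[of p "E k q" 0 0 0 0] d E_Jh by simp_all
  moreover from this d have "q = 0"
    using E_eq_0 by blast
  ultimately show ?thesis
    using d by simp
qed

end

subsection \<open>Two group laws\<close>

text \<open>Abstracts from the map: \<oplus> stands for the transported addition, and
  multiplicativity survives as \<open>mults_pl\<close>. The faithfulness axioms are conditions (i)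
  to (iii).\<close>

locale peirce_two_additions = peirce e for e :: "'a::jordan_ring" +
  fixes n :: nat and pl :: "'a \<Rightarrow> 'a \<Rightarrow> 'a"  (infixl "\<oplus>" 65)
  assumes n: "n \<ge> 2"
    and faithful_J1: "\<lbrakk>a \<in> peirce_one e; \<And>t. t \<in> peirce_half e \<Longrightarrow> t * a = 0\<rbrakk> \<Longrightarrow> a = 0"
    and faithful_J0: "\<lbrakk>a \<in> peirce_zero e; \<And>t. t \<in> peirce_half e \<Longrightarrow> t * a = 0\<rbrakk> \<Longrightarrow> a = 0"
    and J0_faithful_J0: "\<lbrakk>a \<in> peirce_zero e; \<And>t. t \<in> peirce_zero e \<Longrightarrow> t * a = 0\<rbrakk> \<Longrightarrow> a = 0"
    and J0_faithful_Jh: "\<lbrakk>a \<in> peirce_half e; \<And>t. t \<in> peirce_zero e \<Longrightarrow> t * a = 0\<rbrakk> \<Longrightarrow> a = 0"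
    and pl_assoc: "(x \<oplus> y) \<oplus> z = x \<oplus> (y \<oplus> z)"
    and pl_commute: "x \<oplus> y = y \<oplus> x"
    and pl_cancel: "x \<oplus> y = x \<oplus> z \<Longrightarrow> y = z"
    and pl_0: "x \<oplus> 0 = x"
    and mults_pl: "Suc (length ts) = n \<Longrightarrow> mults ts (x \<oplus> y) = mults ts x \<oplus> mults ts y"
begin

section \<open>Operators over which the second law distributes\<close>

lemma pl_0_left: "0 \<oplus> x = x"
  using pl_0 pl_commute by metis

definition multipliers :: "'a list set"
  where "multipliers = {ts. set ts \<subseteq> J0 \<and> Suc (length ts) = n}"

lemma multipliers_simps:
  assumes "ts \<in> multipliers"
  shows "mults ts (x \<oplus> y) = mults ts x \<oplus> mults ts y"
    and "x \<in> Jh \<Longrightarrow> mults ts x \<in> Jh"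
    and "x \<in> J0 \<Longrightarrow> mults ts x \<in> J0"
    and "x \<in> J1 \<Longrightarrow> mults ts x = 0"
proof -
  have "ts \<noteq> []"
    using n assms by (auto simp: multipliers_def)
  with assms show "mults ts (x \<oplus> y) = mults ts x \<oplus> mults ts y"
    and "x \<in> Jh \<Longrightarrow> mults ts x \<in> Jh"
    and "x \<in> J0 \<Longrightarrow> mults ts x \<in> J0"
    and "x \<in> J1 \<Longrightarrow> mults ts x = 0"
    by (simp_all add: multipliers_def mults_pl mults_J0_in_Jh mults_J0_in_J0 mults_J0_J1)
qed

text \<open>The outermost factor is stripped off first: the inner product stays in \<open>Jh\<close>
  or \<open>J0\<close>, on both of which \<open>J0\<close> acts faithfully.\<close>

lemma mults_J0_faithful:
  assumes "x \<in> Jh \<or> x \<in> J0"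
    and "\<And>ts. set ts \<subseteq> J0 \<Longrightarrow> length ts = k \<Longrightarrow> mults ts x = 0"
  shows "x = 0"
  using assms(2)
proof (induction k)
  case (Suc k)
  have "mults ts x = 0" if ts: "set ts \<subseteq> J0" "length ts = k" for ts
  proof -
    have "t * mults ts x = 0" if "t \<in> J0" for t
      using Suc.prems[of "t # ts"] ts that by simp
    then show ?thesis
      using assms(1) ts J0_faithful_J0[of "mults ts x"] J0_faithful_Jh[of "mults ts x"]
        mults_J0_in_Jh mults_J0_in_J0 by blast
  qed
  then show ?case by (rule Suc.IH)
qed (use Suc_length_conv in simp)

lemma multipliers_faithful:
  assumes "x \<in> Jh \<or> x \<in> J0" and "\<And>ts. ts \<in> multipliers \<Longrightarrow> mults ts x = 0"
  shows "x = 0"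
proof (rule mults_J0_faithful[OF assms(1)])
  show "mults ts x = 0" if "set ts \<subseteq> J0" "length ts = n - 1" for ts
    using assms(2)[of ts] n that by (simp add: multipliers_def)
qed

text \<open>All multipliers kill \<open>x - y\<close>. They preserve \<open>Jh\<close> and
  \<open>J0\<close>, so they kill its components there separately, and these vanish by
  faithfulness.\<close>

lemma multipliers_cong_imp:
  assumes "\<And>ts. ts \<in> multipliers \<Longrightarrow> mults ts x = mults ts y"
  shows "x - y \<in> J1"
proof -
  obtain p q r where d: "p \<in> J1" "q \<in> Jh" "r \<in> J0" "x - y = p + q + r"
    by (rule decompose)
  have *: "mults ts q = 0 \<and> mults ts r = 0" if "ts \<in> multipliers" for ts
  proof -
    have "0 + mults ts q + mults ts r = 0 + 0 + 0"
      using assms[OF that] d(1) arg_cong[OF d(4), of "mults ts"] that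
      by (simp add: mults_add mults_diff multipliers_simps)
    then show ?thesis
      using components_eq[of 0 "mults ts q" "mults ts r" 0 0 0] d that
      by (simp add: multipliers_simps)
  qed
  have "q = 0" "r = 0"
    using * d by (blast intro: multipliers_faithful)+
  with d show ?thesis by simp
qed

text \<open>With \<open>n - 1\<close> factors \<open>e\<close>, the value \<open>D x\<close> is a
  full product of \<open>n\<close> factors, so \<oplus> passes through it.\<close>

definition D :: "'a \<Rightarrow> 'a"
  where "D = E (n - 1)"

lemma D_pl: "D (x \<oplus> y) = D x \<oplus> D y"
  using n by (simp add: D_def mults_pl)

lemma D_simps:
  "D (x + y) = D x + D y"
  "x \<in> J1 \<Longrightarrow> D x = x"
  "x \<in> J0 \<Longrightarrow> D x = 0"
  "x \<in> Jh \<Longrightarrow> D x \<in> Jh"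
  "D 0 = 0"
  using n by (simp_all add: D_def mults_add E_J1 E_J0 E_Jh)

lemma D_cong_imp: "D x = D y \<Longrightarrow> x - y \<in> J0"
  using n by (simp add: D_def E_cong_imp)

lemma D_surj: "x \<in> Jh \<Longrightarrow> \<exists>y\<in>Jh. D y = x"
  by (simp add: D_def E_Jh_surj)

text \<open>One factor \<open>e\<close> fewer than in \<open>D\<close> leaves room for a free factor
  \<open>t\<close>: both \<open>C (t * x)\<close> and \<open>t * C x\<close> are products of
  \<open>n\<close> factors. For \<open>n = 2\<close> this is the identity.\<close>

definition C :: "'a \<Rightarrow> 'a"
  where "C = E (n - 2)"

lemma C_simps:
  "C (x + y) = C x + C y"
  "C (x - y) = C x - C y"
  "x \<in> J1 \<Longrightarrow> C x = x"
  "x \<in> Jh \<Longrightarrow> C x \<in> Jh"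
  "x \<in> J0 \<Longrightarrow> C x \<in> J0"
  "C (e * x) = D x"
proof -
  have "replicate (n - 1) e = replicate (n - 2) e @ [e]"
    using n by (simp add: replicate_append_same numeral_2_eq_2 Suc_diff_Suc flip: replicate_Suc)
  then show "C (e * x) = D x"
    by (simp add: C_def D_def)
qed (simp_all add: C_def mults_add mults_diff E_J1 E_Jh E_in_J0)

lemma C_mult_pl: "C (t * (x \<oplus> y)) = C (t * x) \<oplus> C (t * y)"
  using n mults_pl[of "replicate (n - 2) e @ [t]"] by (simp add: C_def)

lemma mult_C_pl: "t * C (x \<oplus> y) = t * C x \<oplus> t * C y"
  using n mults_pl[of "t # replicate (n - 2) e"] by (simp add: C_def)

section \<open>Summands in different Peirce spaces\<close>

lemma Jh_pl_J0_diff: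
  assumes "a \<in> Jh" "b \<in> J0"
  shows "(a \<oplus> b) - (a + b) \<in> J0"
  by (rule D_cong_imp) (use assms in \<open>simp add: D_pl D_simps pl_0\<close>)

text \<open>The multipliers confine the error \<open>d\<close> to \<open>J1\<close>. Then
  \<open>t * d\<close> is part of the \<open>Jh\<close> component of
  \<open>t * C (a \<oplus> b)\<close>, and the multipliers remove the unwanted \<open>J1\<close>
  part of \<open>t * C b\<close>.\<close>

lemma J1_pl_Jh:
  assumes "a \<in> J1" "b \<in> Jh"
  shows "a \<oplus> b = a + b"
proof -
  define d where "d = (a \<oplus> b) - (a + b)"
  have pl: "a \<oplus> b = a + b + d" by (simp add: d_def)
  have d: "d \<in> J1"
    unfolding d_def
    by (rule multipliers_cong_imp) (use assms in \<open>simp add: multipliers_simps pl_0_left mults_add\<close>)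
  have "t * d = 0" if t: "t \<in> Jh" for t
  proof (rule multipliers_faithful)
    show "t * d \<in> Jh \<or> t * d \<in> J0"
      using mult_Jh d t by blast
    fix ts assume ts: "ts \<in> multipliers"
    obtain p r where pr: "p \<in> J1" "r \<in> J0" "t * C b = p + r"
      using mult_Jh_Jh C_simps(4) assms t by metis
    have "t * C (a \<oplus> b) = t * a \<oplus> (p + r)"
      using assms pr by (simp add: mult_C_pl C_simps)
    moreover have "t * C (a \<oplus> b) = t * a + (p + r) + t * d"
      using assms pr d by (simp add: pl C_simps nonassoc_distribs)
    ultimately have "mults ts (t * a \<oplus> (p + r)) = mults ts (t * a + (p + r) + t * d)"
      by simp
    then have "mults ts (t * a) \<oplus> mults ts r = mults ts (t * a) + mults ts r + mults ts (t * d)"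
      using ts pr(1) by (simp add: mults_add multipliers_simps)
    moreover have "mults ts (t * a) \<in> Jh" "mults ts r \<in> J0" "mults ts (t * d) \<in> Jh"
      using assms t ts pr d mult_Jh by (simp_all add: multipliers_simps)
    \<comment> \<open>The equation exhibits \<open>mults ts (t * d)\<close> as the error of a sum
      from \<open>Jh\<close> and \<open>J0\<close>, which lies in \<open>J0\<close>; it also lies in
      \<open>Jh\<close>.\<close>
    ultimately show "mults ts (t * d) = 0"
      using Jh_pl_J0_diff[of "mults ts (t * a)" "mults ts r"] half_zero_inter by simp
  qed
  with faithful_J1 d have "d = 0" by blast
  with pl show ?thesis by simp
qed

text \<open>Mirror image of \<open>J1_pl_Jh\<close>: here \<open>D\<close> removes the
  \<open>J0\<close> part of \<open>t * a\<close>. The operator \<open>C\<close> stands outside the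
  product, since \<open>C b = 0\<close> for \<open>n > 2\<close>.\<close>

lemma Jh_pl_J0:
  assumes "a \<in> Jh" "b \<in> J0"
  shows "a \<oplus> b = a + b"
proof -
  define d where "d = (a \<oplus> b) - (a + b)"
  have pl: "a \<oplus> b = a + b + d" by (simp add: d_def)
  have d: "d \<in> J0"
    unfolding d_def using Jh_pl_J0_diff[OF assms] .
  have "t * d = 0" if t: "t \<in> Jh" for t
  proof -
    obtain p r where pr: "p \<in> J1" "r \<in> J0" "t * a = p + r"
      using mult_Jh_Jh assms t by metis
    have tb: "t * b \<in> Jh" and td: "t * d \<in> Jh"
      using mult_Jh t assms d by blast+
    have C_D: "D (C x) = C (D x)" for x
      by (simp add: C_def D_def flip: mults_append replicate_add) (simp add: add.commute)
    have "D (C (t * (a \<oplus> b))) = p \<oplus> D (C (t * b))"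
      using pr by (simp add: C_mult_pl D_pl C_D) (simp add: D_simps C_simps)
    also have "\<dots> = p + D (C (t * b))"
      using J1_pl_Jh pr tb by (simp add: D_simps C_simps)
    finally have "D (C (t * d)) = 0"
      using pr by (simp add: pl nonassoc_distribs C_D D_simps C_simps)
    then show ?thesis
      using td by (metis C_def C_simps(4) D_def E_eq_0)
  qed
  with faithful_J0 d have "d = 0" by blast
  with pl show ?thesis by simp
qed

text \<open>The multipliers do not see \<open>a\<close> and \<open>D\<close> does not see
  \<open>c\<close>, so the error lies in both \<open>J1\<close> and \<open>J0\<close>.\<close>

lemma pl_Peirce:
  assumes "a \<in> J1" "b \<in> Jh" "c \<in> J0"
  shows "a \<oplus> b \<oplus> c = a + b + c"
proof -
  let ?d = "(a \<oplus> b \<oplus> c) - (a + b + c)"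
  have "?d \<in> J1"
    by (rule multipliers_cong_imp)
      (use assms in \<open>simp add: multipliers_simps pl_0_left mults_add Jh_pl_J0\<close>)
  moreover have "?d \<in> J0"
    by (rule D_cong_imp) (use assms in \<open>simp add: D_pl D_simps pl_0 J1_pl_Jh\<close>)
  ultimately show ?thesis
    using one_zero_inter by fastforce
qed

lemma J1_pl_J0:
  assumes "a \<in> J1" "c \<in> J0"
  shows "a \<oplus> c = a + c"
  using pl_Peirce[of a 0 c] assms by (simp add: pl_0)

section \<open>Summands in the same Peirce space\<close>

lemma J1_pl_J1_in:
  assumes "a \<in> J1" "b \<in> J1"
  shows "a \<oplus> b \<in> J1"
  using multipliers_cong_imp[of "a \<oplus> b" 0] assms by (simp add: multipliers_simps pl_0)

lemma J0_pl_J0_in: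
  assumes "a \<in> J0" "b \<in> J0"
  shows "a \<oplus> b \<in> J0"
  using D_cong_imp[of "a \<oplus> b" 0] assms by (simp add: D_pl D_simps pl_0)

lemma Jh_pl_Jh_diff:
  assumes "a \<in> Jh" "b \<in> Jh"
  shows "(a \<oplus> b) - (a + b) \<in> J1"
proof (rule multipliers_cong_imp)
  fix ts assume ts: "ts \<in> multipliers"
  \<comment> \<open>Preimages under \<open>D\<close> make the mixed terms \<open>C (x * e)\<close>
    and \<open>C (e * y)\<close> exactly \<open>a\<close> and \<open>b\<close>.\<close>
  obtain x y where x: "x \<in> Jh" "D x = a" and y: "y \<in> Jh" "D y = b"
    using D_surj assms by blast
  obtain p r where pr: "p \<in> J1" "r \<in> J0" "x * y = p + r"
    using mult_Jh_Jh x y by metis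
  define s where "s = C r"
  have s: "s \<in> J0"
    using pr by (simp add: s_def C_simps)
  have ey: "e + y = e \<oplus> y" and ex: "e + x = e \<oplus> x"
    using J1_pl_Jh e_in_J1 x y by simp_all
  have "C ((e + x) * (e + y)) = e + a + b + (p + s)"
    using x y pr e_in_J1 by (simp add: nonassoc_distribs C_simps jordan_commute[of x e] s_def idem add_ac)
  moreover have "C ((e + x) * (e + y)) = (e \<oplus> a) \<oplus> (b \<oplus> (p + s))"
  proof -
    have "C ((e + x) * (e + y)) = C ((e + x) * e) \<oplus> C ((e + x) * y)"
      unfolding ey by (rule C_mult_pl)
    also have "C ((e + x) * e) = e \<oplus> a"
    proof -
      have "C ((e + x) * e) = C (e * (e \<oplus> x))"
        by (simp only: ex jordan_commute[of "e \<oplus> x" e])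
      also have "\<dots> = D e \<oplus> D x"
        by (simp only: C_mult_pl C_simps)
      finally show ?thesis
        using x e_in_J1 by (simp add: D_simps)
    qed
    also have "C ((e + x) * y) = b \<oplus> C (y * x)"
    proof -
      have "C ((e + x) * y) = C (y * (e \<oplus> x))"
        by (simp only: ex jordan_commute[of "e \<oplus> x" y])
      also have "\<dots> = D y \<oplus> C (y * x)"
        by (simp only: C_mult_pl C_simps jordan_commute[of y e])
      finally show ?thesis
        using y by simp
    qed
    also have "C (y * x) = p + s"
      using pr by (simp add: jordan_commute[of y x] C_simps s_def)
    finally show ?thesis .
  qed
  ultimately have "mults ts (e + a + b + (p + s)) = mults ts ((e \<oplus> a) \<oplus> (b \<oplus> (p + s)))"
    by simp
  \<comment> \<open>The multipliers kill \<open>e\<close> and \<open>p\<close>, both in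
    \<open>J1\<close>. The remaining \<open>s\<close> lies in \<open>J0\<close>, where
    \<open>Jh_pl_J0\<close> allows it to be cancelled.\<close>
  then have "mults ts (a + b) + mults ts s = mults ts (a \<oplus> b) \<oplus> mults ts s"
    using ts pr e_in_J1
    by (simp add: multipliers_simps pl_0_left mults_add pl_assoc)
  moreover have "mults ts (a + b) + mults ts s = mults ts (a + b) \<oplus> mults ts s"
    using Jh_pl_J0 ts s add_in assms by (simp add: multipliers_simps)
  ultimately show "mults ts (a \<oplus> b) = mults ts (a + b)"
    using pl_cancel[of "mults ts s"] pl_commute by metis
qed

text \<open>Multiplication by \<open>t\<close> takes both summands into \<open>J1 + J0\<close>.
  Regrouped by Peirce spaces, their \<oplus>-sum has no \<open>Jh\<close> component, whereas the
  expansion with \<open>+\<close> has \<open>t * d\<close> there.\<close>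

lemma Jh_pl_Jh:
  assumes "a \<in> Jh" "b \<in> Jh"
  shows "a \<oplus> b = a + b"
proof -
  define d where "d = (a \<oplus> b) - (a + b)"
  have pl: "a \<oplus> b = a + b + d" by (simp add: d_def)
  have d: "d \<in> J1"
    unfolding d_def using Jh_pl_Jh_diff[OF assms] .
  have "t * d = 0" if t: "t \<in> Jh" for t
  proof -
    obtain p r where pr: "p \<in> J1" "r \<in> J0" "t * C a = p + r"
      using mult_Jh_Jh C_simps(4) assms t by metis
    obtain p' r' where pr': "p' \<in> J1" "r' \<in> J0" "t * C b = p' + r'"
      using mult_Jh_Jh C_simps(4) assms t by metis
    have "t * C (a \<oplus> b) = (p \<oplus> r) \<oplus> (p' \<oplus> r')"
      using pr pr' by (simp add: mult_C_pl J1_pl_J0)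
    also have "\<dots> = (p \<oplus> p') \<oplus> (r \<oplus> r')"
      by (metis pl_assoc pl_commute)
    also have "\<dots> = (p \<oplus> p') + (r \<oplus> r')"
      using J1_pl_J0 J1_pl_J1_in J0_pl_J0_in pr pr' by simp
    also have "t * C (a \<oplus> b) = (p + p') + t * d + (r + r')"
      using d pr pr' by (simp add: pl C_simps nonassoc_distribs add_ac)
    finally have "(p + p') + t * d + (r + r') = (p \<oplus> p') + 0 + (r \<oplus> r')"
      by simp
    then show ?thesis
      using components_eq[of "p + p'" "t * d" "r + r'" "p \<oplus> p'" 0 "r \<oplus> r'"]
        pr pr' mult_Jh d t by (simp add: add_in J1_pl_J1_in J0_pl_J0_in)
  qed
  with faithful_J1 d have "d = 0" by blast
  with pl show ?thesis by simp
qed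

text \<open>Multiplication by \<open>t\<close> moves the claim into \<open>Jh\<close>, where the two
  laws agree.\<close>

lemma J1_pl_J1:
  assumes "a \<in> J1" "b \<in> J1"
  shows "a \<oplus> b = a + b"
proof -
  have d: "(a \<oplus> b) - (a + b) \<in> J1"
    using diff_in add_in J1_pl_J1_in assms by simp
  moreover have "t * ((a \<oplus> b) - (a + b)) = 0" if t: "t \<in> Jh" for t
    using mult_C_pl[of t a b] assms J1_pl_J1_in mult_Jh[OF t]
    by (simp add: C_simps nonassoc_distribs Jh_pl_Jh)
  ultimately have "(a \<oplus> b) - (a + b) = 0" by (rule faithful_J1)
  then show ?thesis by simp
qed

text \<open>As for \<open>J1\<close>, but with \<open>C\<close> applied after \<open>t\<close>;
  injectivity of \<open>C\<close> on \<open>Jh\<close> then removes it.\<close>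

lemma J0_pl_J0:
  assumes "a \<in> J0" "b \<in> J0"
  shows "a \<oplus> b = a + b"
proof -
  have d: "(a \<oplus> b) - (a + b) \<in> J0"
    using diff_in add_in J0_pl_J0_in assms by simp
  moreover have "t * ((a \<oplus> b) - (a + b)) = 0" if t: "t \<in> Jh" for t
  proof -
    have "C (t * ((a \<oplus> b) - (a + b))) = 0"
      using C_mult_pl[of t a b] assms mult_Jh[OF t]
      by (simp add: C_simps nonassoc_distribs Jh_pl_Jh)
    moreover have "t * ((a \<oplus> b) - (a + b)) \<in> Jh"
      using mult_Jh t d by blast
    ultimately show ?thesis
      unfolding C_def by (rule E_eq_0[rotated])
  qed
  ultimately have "(a \<oplus> b) - (a + b) = 0" by (rule faithful_J0)
  then show ?thesis by simp
qed

theorem pl_eq_add: "x \<oplus> y = x + y"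
proof -
  obtain a b c where x: "a \<in> J1" "b \<in> Jh" "c \<in> J0" "x = a + b + c"
    by (rule decompose)
  obtain a' b' c' where y: "a' \<in> J1" "b' \<in> Jh" "c' \<in> J0" "y = a' + b' + c'"
    by (rule decompose)
  have "x \<oplus> y = (a \<oplus> b \<oplus> c) \<oplus> (a' \<oplus> b' \<oplus> c')"
    using x y by (simp add: pl_Peirce)
  also have "\<dots> = (a \<oplus> a') \<oplus> (b \<oplus> b') \<oplus> (c \<oplus> c')"
    by (metis pl_assoc pl_commute)
  also have "\<dots> = (a + a') \<oplus> (b + b') \<oplus> (c + c')"
    using x y by (simp add: J1_pl_J1 Jh_pl_Jh J0_pl_J0)
  also have "\<dots> = (a + a') + (b + b') + (c + c')"
    using x y by (intro pl_Peirce add_in)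
  also have "\<dots> = x + y"
    using x y by (simp add: add_ac)
  finally show ?thesis .
qed

end

subsection \<open>Multiplicative maps\<close>

text \<open>These monomials, nested to the right, make the values of \<open>mults\<close> instances
  of the hypothesis on \<phi>.\<close>

lemma subst_value_left_normed:
  "subst_value y (foldr Prod (map Var is) (Var k)) = mults (map y is) (y k)"
  by (induction "is") simp_all

lemma degree_left_normed: "degree (foldr Prod (map Var is) (Var k)) = Suc (length is)"
  by (induction "is") simp_all

lemma vars_left_normed: "vars (foldr Prod (map Var is) (Var k)) = insert k (set is)"
  by (induction "is") auto

lemma n_multiplicative_iso_mults:
  assumes "n_multiplicative_iso n \<phi>" and "Suc (length ts) = n"
  shows "\<phi> (mults ts x) = mults (map \<phi> ts) (\<phi> x)"
proof -
  define m where "m = foldr Prod (map Var [1..<n]) (Var n)"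
  \<comment> \<open>Variables count from 1 and list positions from 0; the last variable
    \<open>n\<close> receives \<open>x\<close>.\<close>
  define y where "y i = (ts @ [x]) ! (i - 1)" for i
  have "degree m = n" "vars m \<subseteq> {1..n}"
    using assms(2) by (auto simp: m_def degree_left_normed vars_left_normed)
  then have "\<phi> (subst_value y m) = subst_value (\<lambda>i. \<phi> (y i)) m"
    using assms(1) by (simp add: n_multiplicative_iso_def)
  moreover have "map y [1..<n] = ts"
    using assms(2) by (intro nth_equalityI) (auto simp: y_def nth_append)
  moreover have "y n = x"
    by (simp add: y_def nth_append flip: assms(2))
  moreover have "map (\<lambda>i. \<phi> (y i)) [1..<n] = map \<phi> (map y [1..<n])"
    by simp
  ultimately show ?thesis
    unfolding m_def subst_value_left_normed by simp
qed

theorem theorem1: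
  fixes n :: nat
    and e :: "'a::jordan_ring"
    and \<phi> :: "'a \<Rightarrow> 'b::jordan_ring"
  assumes "n \<ge> 2"
    and "torsion_free 2 TYPE('a)"
    and "nontrivial_idempotent e"
    and "\<forall>A \<in> {peirce_one e, peirce_zero e}. \<forall>a \<in> A.
          (\<forall>t \<in> peirce_half e. t * a = 0) \<longrightarrow> a = 0"
    and "\<forall>a \<in> peirce_zero e. (\<forall>t \<in> peirce_zero e. t * a = 0) \<longrightarrow> a = 0"
    and "\<forall>a \<in> peirce_half e. (\<forall>t \<in> peirce_zero e. t * a = 0) \<longrightarrow> a = 0"
    and "n_multiplicative_iso n \<phi>"
  shows "\<forall>a b. \<phi> (a + b) = \<phi> a + \<phi> b"
proof -
  have idem: "e * e = e"
    using assms(3) by (simp add: nontrivial_idempotent_def)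
  have bij: "bij \<phi>"
    using assms(7) by (simp add: n_multiplicative_iso_def)
  define \<psi> where "\<psi> = inv \<phi>"
  have \<phi>\<psi>: "\<phi> (\<psi> z) = z" and \<psi>\<phi>: "\<psi> (\<phi> x) = x" for x z
    using bij by (simp_all add: \<psi>_def bij_is_surj bij_is_inj surj_f_inv_f)
  have mults: "\<phi> (mults ts x) = mults (map \<phi> ts) (\<phi> x)" if "Suc (length ts) = n" for ts x
    using n_multiplicative_iso_mults[OF assms(7) that] .
  have \<phi>_0: "\<phi> 0 = 0"
  proof -
    obtain k where k: "n = Suc (Suc k)"
      using assms(1) by (metis add_2_eq_Suc le_Suc_ex)
    \<comment> \<open>The leading factor is the preimage of 0, so the product of images vanishes,
      while the product in the source is 0 as well. The bound \<open>n \<ge> 2\<close> makes room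
      for this factor.\<close>
    show ?thesis
      using mults[of "\<psi> 0 # replicate k 0" 0] by (simp add: k \<phi>\<psi> nonassoc_mult_zero_left)
  qed
  define pl where "pl x y = \<psi> (\<phi> x + \<phi> y)" for x y
  interpret peirce_two_additions e n pl
  proof unfold_locales
    show "Suc (length ts) = n \<Longrightarrow> mults ts (pl x y) = pl (mults ts x) (mults ts y)" for ts x y
      using mults[of ts] \<psi>\<phi>[of "mults ts (pl x y)"] by (simp add: pl_def \<phi>\<psi> mults_add)
    show "pl x y = pl x z \<Longrightarrow> y = z" for x y z
      unfolding pl_def by (metis \<phi>\<psi> \<psi>\<phi> add_left_cancel)
  qed (use assms idem in \<open>auto simp: pl_def \<phi>\<psi> \<psi>\<phi> \<phi>_0 add_ac\<close>)
  show ?thesis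
    using pl_eq_add \<phi>\<psi> by (metis pl_def)
qed

end
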